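(* Let $(X,d_X)$ and $(Y,d_Y)$ be metric spaces and let $f\colon X\to X$ and $g\colon Y\to Y$ be maps. Assume that there exists a surjective coarse equivalence $\varphi\colon X\to Y$ such that $\varphi\circ f$ is close to $g\circ\varphi$. Then, for any map $\psi\colon Y\to X$ such that $\varphi\circ\psi=\mathrm{id}_Y$, the maps $f$ and $g$ are coarsely conjugate via $\varphi$ and $\psi$.
   Context: Let $(X,d_X)$ and $(Y,d_Y)$ be metric spaces. Two maps $a,b$ from a set $S$ to $Y$ are close if $\sup_{x\in S} d_Y(a(x),b(x))<\infty$. A map $\varphi\colon X\to Y$ is controlled if there exists a non-decreasing function $\rho\colon[0,\infty)\to[0,\infty)$ such that $d_Y(\varphi(x),\varphi(x'))\le\rho(d_X(x,x'))$ for all $x,x'\in X$. A controlled map $\varphi\colon X\to Y$ is a coarse equivalence if it admits a coarse inverse, that is, a controlled map $\psi\colon Y\to X$ such that $\varphi\circ\psi$ and $\psi\circ\varphi$ are close to the respective identity maps. Maps $f\colon X\to X$ and $g\colon Y\to Y$ are coarsely conjugate via $\varphi$ and $\psi$ if $\varphi\colon X\to Y$ is a coarse equivalence with coarse inverse $\psi\colon Y\to X$ such that $\varphi\circ f$ is close to $g\circ\varphi$ and $\psi\circ g$ is close to $f\circ\psi$. No assumption (such as being controlled) is made on $f$ and $g$. *)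

theory Defs
  imports "HOL-Analysis.Analysis"
begin

text \<open>
  Metric spaces are carrier-based (\<^locale>\<open>Metric_space\<close>), so that the empty space is covered and
  maps matter only on the carrier; a map from \<open>X\<close> to \<open>Y\<close> is an element of \<open>X \<rightarrow> Y\<close>.
\<close>

text \<open>The supremum is taken in \<^typ>\<open>ereal\<close>, because a real supremum of an unbounded set is unspecified.\<close>

definition close_maps :: "'s set \<Rightarrow> ('b \<Rightarrow> 'b \<Rightarrow> real) \<Rightarrow> ('s \<Rightarrow> 'b) \<Rightarrow> ('s \<Rightarrow> 'b) \<Rightarrow> bool" where
  "close_maps S d a b \<longleftrightarrow> (SUP x\<in>S. ereal (d (a x) (b x))) < \<infinity>"

definition controlled_map ::
  "'a set \<Rightarrow> ('a \<Rightarrow> 'a \<Rightarrow> real) \<Rightarrow> 'b set \<Rightarrow> ('b \<Rightarrow> 'b \<Rightarrow> real) \<Rightarrow> ('a \<Rightarrow> 'b) \<Rightarrow> bool" where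
  "controlled_map X dX Y dY \<phi> \<longleftrightarrow>
     \<phi> \<in> X \<rightarrow> Y \<and>
     (\<exists>\<rho>::real \<Rightarrow> real. \<rho> \<in> {0..} \<rightarrow> {0..} \<and> mono_on {0..} \<rho> \<and>
        (\<forall>x\<in>X. \<forall>x'\<in>X. dY (\<phi> x) (\<phi> x') \<le> \<rho> (dX x x')))"

definition coarse_inverse ::
  "'a set \<Rightarrow> ('a \<Rightarrow> 'a \<Rightarrow> real) \<Rightarrow> 'b set \<Rightarrow> ('b \<Rightarrow> 'b \<Rightarrow> real) \<Rightarrow> ('a \<Rightarrow> 'b) \<Rightarrow> ('b \<Rightarrow> 'a) \<Rightarrow> bool" where
  "coarse_inverse X dX Y dY \<phi> \<psi> \<longleftrightarrow>
     controlled_map Y dY X dX \<psi> \<and>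
     close_maps Y dY (\<phi> \<circ> \<psi>) id \<and> close_maps X dX (\<psi> \<circ> \<phi>) id"

definition coarse_equivalence ::
  "'a set \<Rightarrow> ('a \<Rightarrow> 'a \<Rightarrow> real) \<Rightarrow> 'b set \<Rightarrow> ('b \<Rightarrow> 'b \<Rightarrow> real) \<Rightarrow> ('a \<Rightarrow> 'b) \<Rightarrow> bool" where
  "coarse_equivalence X dX Y dY \<phi> \<longleftrightarrow>
     controlled_map X dX Y dY \<phi> \<and> (\<exists>\<psi>. coarse_inverse X dX Y dY \<phi> \<psi>)"

definition coarsely_conjugate_via ::
  "'a set \<Rightarrow> ('a \<Rightarrow> 'a \<Rightarrow> real) \<Rightarrow> 'b set \<Rightarrow> ('b \<Rightarrow> 'b \<Rightarrow> real) \<Rightarrow>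
   ('a \<Rightarrow> 'a) \<Rightarrow> ('b \<Rightarrow> 'b) \<Rightarrow> ('a \<Rightarrow> 'b) \<Rightarrow> ('b \<Rightarrow> 'a) \<Rightarrow> bool" where
  "coarsely_conjugate_via X dX Y dY f g \<phi> \<psi> \<longleftrightarrow>
     f \<in> X \<rightarrow> X \<and> g \<in> Y \<rightarrow> Y \<and>
     coarse_equivalence X dX Y dY \<phi> \<and> coarse_inverse X dX Y dY \<phi> \<psi> \<and>
     close_maps X dY (\<phi> \<circ> f) (g \<circ> \<phi>) \<and> close_maps Y dX (\<psi> \<circ> g) (f \<circ> \<psi>)"

end

theory Submission
  imports Defs
begin

text \<open>
  A coarse equivalence \<open>\<phi>\<close> also bounds distances from below: there is a non-decreasing \<open>\<eta>\<close> with
  \<open>dX x x' \<le> \<eta> (dY (\<phi> x) (\<phi> x'))\<close> (lemma \<open>coarse_equivalence_lower_control\<close>). Hence, to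
  bound the distance of two points of \<open>X\<close>, it suffices to bound the distance of their images.
  For a section \<open>\<psi>\<close> of \<open>\<phi>\<close> this settles everything: the images of \<open>\<psi> y\<close> and \<open>\<psi> y'\<close> are \<open>y\<close>
  and \<open>y'\<close>, so \<open>\<psi>\<close> is controlled by \<open>\<eta>\<close>; the points \<open>\<psi> (\<phi> x)\<close> and \<open>x\<close> have the same image;
  and the images of \<open>\<psi> (g y)\<close> and \<open>f (\<psi> y)\<close> are \<open>g (\<phi> (\<psi> y))\<close> and \<open>\<phi> (f (\<psi> y))\<close>, which are
  uniformly close because \<open>\<phi> \<circ> f\<close> is close to \<open>g \<circ> \<phi>\<close>.
\<close>

text \<open>
  Asking for a non-negative bound costs nothing, as bounds can be enlarged, and makes the bound an
  admissible argument of control functions, which are constrained on \<open>{0..}\<close> only.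
\<close>

lemma close_maps_iff_bounded:
  "close_maps S d a b \<longleftrightarrow> (\<exists>C\<ge>0. \<forall>x\<in>S. d (a x) (b x) \<le> C)"
proof
  assume "close_maps S d a b"
  then obtain r where r: "(SUP x\<in>S. ereal (d (a x) (b x))) < ereal r"
    unfolding close_maps_def using ereal_dense2[of _ \<infinity>] by blast
  have "d (a x) (b x) \<le> max r 0" if "x \<in> S" for x
  proof -
    have "ereal (d (a x) (b x)) < ereal r"
      using SUP_upper[OF that] r by (rule le_less_trans)
    then show ?thesis by simp
  qed
  then show "\<exists>C\<ge>0. \<forall>x\<in>S. d (a x) (b x) \<le> C"
    by (intro exI[of _ "max r 0"]) simp
next
  assume "\<exists>C\<ge>0. \<forall>x\<in>S. d (a x) (b x) \<le> C"
  then obtain C where "\<forall>x\<in>S. d (a x) (b x) \<le> C" by blast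
  then have "(SUP x\<in>S. ereal (d (a x) (b x))) \<le> ereal C"
    by (intro SUP_least) simp
  then show "close_maps S d a b"
    unfolding close_maps_def by (rule le_less_trans) simp
qed

text \<open>
  If \<open>\<xi>\<close> is a coarse inverse controlled by \<open>\<rho>\<close>, and \<open>\<xi> \<circ> \<phi>\<close> is within \<open>C\<close> of the identity, then
  passing from \<open>x\<close> to \<open>x'\<close> through \<open>\<xi> (\<phi> x)\<close> and \<open>\<xi> (\<phi> x')\<close> gives \<open>\<eta> t = \<rho> t + 2 * C\<close>.
\<close>

lemma coarse_equivalence_lower_control:
  assumes "Metric_space X dX" and "coarse_equivalence X dX Y dY \<phi>"
  obtains \<eta> :: "real \<Rightarrow> real"
  where "\<eta> \<in> {0..} \<rightarrow> {0..}" and "mono_on {0..} \<eta>"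
    and "\<And>x x'. x \<in> X \<Longrightarrow> x' \<in> X \<Longrightarrow> dX x x' \<le> \<eta> (dY (\<phi> x) (\<phi> x'))"
proof -
  interpret X: Metric_space X dX by fact
  obtain \<xi> where "coarse_inverse X dX Y dY \<phi> \<xi>" and "\<phi> \<in> X \<rightarrow> Y"
    using assms(2) unfolding coarse_equivalence_def controlled_map_def by blast
  then obtain \<rho> :: "real \<Rightarrow> real" and C
    where \<xi>: "\<xi> \<in> Y \<rightarrow> X" and \<rho>: "\<rho> \<in> {0..} \<rightarrow> {0..}" "mono_on {0..} \<rho>"
      and \<rho>_bound: "\<And>y y'. y \<in> Y \<Longrightarrow> y' \<in> Y \<Longrightarrow> dX (\<xi> y) (\<xi> y') \<le> \<rho> (dY y y')"
      and C: "C \<ge> 0" "\<And>x. x \<in> X \<Longrightarrow> dX (\<xi> (\<phi> x)) x \<le> C"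
    unfolding coarse_inverse_def controlled_map_def close_maps_iff_bounded by auto
  show thesis
  proof (rule that[of "\<lambda>t. \<rho> t + 2 * C"])
    show "(\<lambda>t. \<rho> t + 2 * C) \<in> {0..} \<rightarrow> {0..}"
      using \<rho>(1) C(1) by (auto simp: Pi_iff)
    show "mono_on {0..} (\<lambda>t. \<rho> t + 2 * C)"
      using \<rho>(2) by (auto simp: mono_on_def)
  next
    fix x x' assume x: "x \<in> X" and x': "x' \<in> X"
    have \<phi>x: "\<phi> x \<in> Y" "\<phi> x' \<in> Y" using x x' \<open>\<phi> \<in> X \<rightarrow> Y\<close> by auto
    then have \<xi>x: "\<xi> (\<phi> x) \<in> X" "\<xi> (\<phi> x') \<in> X" using \<xi> by auto
    have "dX x x' \<le> dX x (\<xi> (\<phi> x)) + dX (\<xi> (\<phi> x)) x'"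
      using x x' \<xi>x by (intro X.triangle)
    also have "dX (\<xi> (\<phi> x)) x' \<le> dX (\<xi> (\<phi> x)) (\<xi> (\<phi> x')) + dX (\<xi> (\<phi> x')) x'"
      using x x' \<xi>x by (intro X.triangle)
    finally show "dX x x' \<le> \<rho> (dY (\<phi> x) (\<phi> x')) + 2 * C"
      using C(2)[OF x] C(2)[OF x'] \<rho>_bound[OF \<phi>x] X.commute[of x "\<xi> (\<phi> x)"] by linarith
  qed
qed

theorem theorem3:
  fixes X :: "'a set" and dX :: "'a \<Rightarrow> 'a \<Rightarrow> real"
    and Y :: "'b set" and dY :: "'b \<Rightarrow> 'b \<Rightarrow> real"
    and f :: "'a \<Rightarrow> 'a" and g :: "'b \<Rightarrow> 'b"
    and \<phi> :: "'a \<Rightarrow> 'b" and \<psi> :: "'b \<Rightarrow> 'a"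
  assumes "Metric_space X dX" and "Metric_space Y dY"
    and "f \<in> X \<rightarrow> X" and "g \<in> Y \<rightarrow> Y"
    and "coarse_equivalence X dX Y dY \<phi>" and "\<phi> ` X = Y"
    and "close_maps X dY (\<phi> \<circ> f) (g \<circ> \<phi>)"
    and "\<psi> \<in> Y \<rightarrow> X" and "\<forall>y\<in>Y. (\<phi> \<circ> \<psi>) y = y"
  shows "coarsely_conjugate_via X dX Y dY f g \<phi> \<psi>"
proof -
  interpret Y: Metric_space Y dY by fact
  have \<phi>_maps: "\<phi> x \<in> Y" if "x \<in> X" for x
    using assms(6) that by auto
  have \<psi>_maps: "\<psi> y \<in> X" and \<phi>\<psi>: "\<phi> (\<psi> y) = y" if "y \<in> Y" for y
    using assms(8,9) that by auto
  obtain \<eta> :: "real \<Rightarrow> real"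
    where \<eta>: "\<eta> \<in> {0..} \<rightarrow> {0..}" "mono_on {0..} \<eta>"
      and \<eta>_bound: "\<And>x x'. x \<in> X \<Longrightarrow> x' \<in> X \<Longrightarrow> dX x x' \<le> \<eta> (dY (\<phi> x) (\<phi> x'))"
    using coarse_equivalence_lower_control[OF assms(1,5)] by metis
  obtain C where C: "C \<ge> 0" "\<And>x. x \<in> X \<Longrightarrow> dY (\<phi> (f x)) (g (\<phi> x)) \<le> C"
    using assms(7) unfolding close_maps_iff_bounded by auto
  have "controlled_map Y dY X dX \<psi>"
    unfolding controlled_map_def
  proof (intro conjI exI[of _ \<eta>] ballI)
    fix y y' assume "y \<in> Y" "y' \<in> Y"
    then show "dX (\<psi> y) (\<psi> y') \<le> \<eta> (dY y y')"
      using \<eta>_bound[of "\<psi> y" "\<psi> y'"] \<psi>_maps \<phi>\<psi> by simp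
  qed (use assms(8) \<eta> in auto)
  moreover have "close_maps Y dY (\<phi> \<circ> \<psi>) id"
    unfolding close_maps_iff_bounded using \<phi>\<psi> by (intro exI[of _ 0]) simp
  moreover have "close_maps X dX (\<psi> \<circ> \<phi>) id"
    unfolding close_maps_iff_bounded
  proof (intro exI[of _ "\<eta> 0"] conjI ballI)
    show "0 \<le> \<eta> 0" using \<eta>(1) by auto
    fix x assume x: "x \<in> X"
    then show "dX ((\<psi> \<circ> \<phi>) x) (id x) \<le> \<eta> 0"
      using \<eta>_bound[of "\<psi> (\<phi> x)" x] \<phi>_maps[OF x] \<psi>_maps \<phi>\<psi> by simp
  qed
  moreover have "close_maps Y dX (\<psi> \<circ> g) (f \<circ> \<psi>)"
    unfolding close_maps_iff_bounded
  proof (intro exI[of _ "\<eta> C"] conjI ballI)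
    show "0 \<le> \<eta> C" using \<eta>(1) C(1) by auto
    fix y assume y: "y \<in> Y"
    have gy: "g y \<in> Y" and fy: "f (\<psi> y) \<in> X"
      using assms(3,4) \<psi>_maps y by auto
    have "dX (\<psi> (g y)) (f (\<psi> y)) \<le> \<eta> (dY (g y) (\<phi> (f (\<psi> y))))"
      using \<eta>_bound[OF \<psi>_maps[OF gy] fy] \<phi>\<psi>[OF gy] by simp
    also have "\<dots> \<le> \<eta> C"
    proof (rule mono_onD[OF \<eta>(2)])
      show "dY (g y) (\<phi> (f (\<psi> y))) \<le> C"
        using C(2)[OF \<psi>_maps[OF y]] \<phi>\<psi>[OF y] by (simp add: Y.commute)
    qed (use C(1) in auto)
    finally show "dX ((\<psi> \<circ> g) y) ((f \<circ> \<psi>) y) \<le> \<eta> C" by simp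
  qed
  ultimately show ?thesis
    using assms unfolding coarsely_conjugate_via_def coarse_inverse_def by blast
qed

end
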